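(* Let $\alpha\in\mathbb{C}_*$ with $\arg(\alpha)\in(0,\pi/6)\cup(\pi/6,\pi/3)$, and let $\ell=\mathbb{C}\cdot(a,b,1)$ be a complex line in $\mathbb{C}^3$ with $\ell\nsubseteq\Delta$. If $\ell^{\ast}:=\bar\ell\cdot g_{\alpha,\ell}(\bar\alpha)^{-1}\nsubseteq\Delta$, then $f_{\alpha,\ell}:=g_{\bar\alpha,\ell^{\ast}}\,g_{\alpha,\ell}\in\Lambda_-^{\tau,\sigma}\mathrm{GL}(3,\mathbb{C})$.
   Context: Notation. $\mathbb{C}_*=\mathbb{C}\setminus\{0\}$, $\epsilon=e^{\pi i/3}$. $\mathcal{O}_r=\{|\lambda|<r\}$, $\mathcal{O}_{1/r}=\{\lambda\in\mathbb{C}\cup\{\infty\}:|\lambda|>1/r\}$, where $0<r<1$ is sufficiently small (depending on the element considered). $\Lambda_-G$ is the set of holomorphic maps $f:\mathcal{O}_r\cup\mathcal{O}_{1/r}\to G$ with $f(\infty)=I$. For an invertible $3\times3$ matrix $g$, $\sigma(g)=T(g^t)^{-1}T^{-1}$ with $T=\begin{pmatrix}0&1&0\\-\epsilon&0&0\\0&0&\epsilon^2\end{pmatrix}$. $\Lambda_-^{\tau,\sigma}G$ is the subgroup of $g\in\Lambda_-G$ with $\overline{g(\bar\lambda)}=g(\lambda)$ and $\sigma(g(\lambda))=g(\epsilon\lambda)$. $\Delta=\{(z_1,z_2,z_3)\in\mathbb{C}^3:2z_1z_2=z_3^2\text{ or }z_3=0\}$. Lines consist of row vectors, multiplied on the right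 by matrices; $\bar\ell$ is the complex conjugate line. A line $\ell\nsubseteq\Delta$ is uniquely of the form $\mathbb{C}\cdot(a,b,1)$ with $2ab\neq1$, and for $\alpha\in\mathbb{C}_*$ $$g_{\alpha,\ell}(\lambda)=I+\frac{2}{\lambda^3-\alpha^3}\begin{pmatrix}\frac{\alpha^3ab}{2ab-1}&\frac{\alpha\lambda^2b^2}{2ab-1}&\frac{\alpha^2\lambda b}{2ab-1}\\ \alpha^2\lambda a^2&\alpha^3ab&\alpha\lambda^2a\\ \alpha\lambda^2a&\alpha^2\lambda b&\alpha^3\end{pmatrix}.$$ *)

theory Defs
  imports "HOL-Analysis.Analysis"
begin

datatype riemann_sphere = Fin complex | Infty

fun sphere_cnj :: "riemann_sphere \<Rightarrow> riemann_sphere" where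
  "sphere_cnj (Fin z) = Fin (cnj z)"
| "sphere_cnj Infty = Infty"

(* multiplication by a nonzero scalar fixes infinity *)
fun sphere_scale :: "complex \<Rightarrow> riemann_sphere \<Rightarrow> riemann_sphere" where
  "sphere_scale c (Fin z) = Fin (c * z)"
| "sphere_scale c Infty = Infty"

definition sphere_inverse :: "complex \<Rightarrow> riemann_sphere" where
  "sphere_inverse w = (if w = 0 then Infty else Fin (1 / w))"

(* The value at infinity of a map given by a formula on the complex plane is its limit there. *)
fun extend_to_sphere :: "(complex \<Rightarrow> complex^3^3) \<Rightarrow> riemann_sphere \<Rightarrow> complex^3^3" where
  "extend_to_sphere h (Fin z) = h z"
| "extend_to_sphere h Infty = Lim at_infinity h"

definition disc_zero :: "real \<Rightarrow> riemann_sphere set" where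
  "disc_zero r = {Fin z | z. norm z < r}"

definition disc_infinity :: "real \<Rightarrow> riemann_sphere set" where
  "disc_infinity r = insert Infty {Fin z | z. norm z > 1 / r}"

definition GL3 :: "(complex^3^3) set" where
  "GL3 = {A. invertible A}"

(* Holomorphy is entrywise, tested in the chart z on the disc around 0 and in the chart w = 1/z,
   which maps the whole disc around infinity onto the ball of radius r, on the other disc. *)
definition loops_minus_on :: "real \<Rightarrow> (complex^3^3) set \<Rightarrow> (riemann_sphere \<Rightarrow> complex^3^3) set" where
  "loops_minus_on r G = {f.
     (\<forall>p \<in> disc_zero r \<union> disc_infinity r. f p \<in> G) \<and>
     (\<forall>i j. (\<lambda>z. f (Fin z) $ i $ j) holomorphic_on ball 0 r) \<and>
     (\<forall>i j. (\<lambda>w. f (sphere_inverse w) $ i $ j) holomorphic_on ball 0 r) \<and>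
     f Infty = mat 1}"

(* One radius, as small as the loop requires, serves both discs. *)
definition loops_minus :: "(complex^3^3) set \<Rightarrow> (riemann_sphere \<Rightarrow> complex^3^3) set" where
  "loops_minus G = (\<Union>r \<in> {0<..<1}. loops_minus_on r G)"

definition eps :: complex where
  "eps = exp (of_real pi * \<i> / 3)"

definition T_mat :: "complex^3^3" where
  "T_mat = vector [vector [0, 1, 0], vector [- eps, 0, 0], vector [0, 0, eps^2]]"

definition sigma :: "complex^3^3 \<Rightarrow> complex^3^3" where
  "sigma g = T_mat ** matrix_inv (transpose g) ** matrix_inv T_mat"

definition twisted_loops_minus :: "(complex^3^3) set \<Rightarrow> (riemann_sphere \<Rightarrow> complex^3^3) set" where
  "twisted_loops_minus G = {f \<in> loops_minus G. \<exists>r \<in> {0<..<1}. f \<in> loops_minus_on r G \<and>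
     (\<forall>p \<in> disc_zero r \<union> disc_infinity r.
        map_matrix cnj (f (sphere_cnj p)) = f p \<and> sigma (f p) = f (sphere_scale eps p))}"

definition Delta :: "(complex^3) set" where
  "Delta = {z. 2 * z$1 * z$2 = (z$3)^2 \<or> z$3 = 0}"

definition row_line :: "complex^3 \<Rightarrow> (complex^3) set" where
  "row_line v = {c *s v | c. True}"

definition line_times :: "(complex^3) set \<Rightarrow> complex^3^3 \<Rightarrow> (complex^3) set" where
  "line_times l A = (\<lambda>v. v v* A) ` l"

definition cnj_line :: "(complex^3) set \<Rightarrow> (complex^3) set" where
  "cnj_line l = (\<lambda>v. \<chi> i. cnj (v$i)) ` l"

(* the unique (a, b) with l = C (a, b, 1); meaningful for lines not contained in Delta *)
definition line_coords :: "(complex^3) set \<Rightarrow> complex \<times> complex" where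
  "line_coords l = (THE (a, b). l = row_line (vector [a, b, 1]))"

lemma line_coords_row_line [simp]: "line_coords (row_line (vector [a, b, 1])) = (a, b)"
proof -
  have uniq: "a' = a \<and> b' = b"
    if eq: "row_line (vector [a, b, 1]) = row_line (vector [a', b', 1])" for a' b' :: complex
  proof -
    have "1 *s (vector [a, b, 1] :: complex^3) \<in> row_line (vector [a, b, 1])"
      unfolding row_line_def by blast
    with eq have "1 *s (vector [a, b, 1] :: complex^3) \<in> row_line (vector [a', b', 1])"
      by simp
    then obtain c where "1 *s (vector [a, b, 1] :: complex^3) = c *s vector [a', b', 1]"
      unfolding row_line_def by blast
    then show ?thesis
      by (simp add: vec_eq_iff forall_3)
  qed
  show ?thesis
    unfolding line_coords_def by (rule the_equality) (use uniq in auto)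
qed

definition g_formula :: "complex \<Rightarrow> complex \<Rightarrow> complex \<Rightarrow> complex \<Rightarrow> complex^3^3" where
  "g_formula \<alpha> a b z = mat 1 + map_matrix ((*) (2 / (z^3 - \<alpha>^3)))
     (vector
       [vector [\<alpha>^3 * a * b / (2 * a * b - 1),
                \<alpha> * z^2 * b^2 / (2 * a * b - 1),
                \<alpha>^2 * z * b / (2 * a * b - 1)],
        vector [\<alpha>^2 * z * a^2, \<alpha>^3 * a * b, \<alpha> * z^2 * a],
        vector [\<alpha> * z^2 * a, \<alpha>^2 * z * b, \<alpha>^3]])"

definition g_loop :: "complex \<Rightarrow> (complex^3) set \<Rightarrow> riemann_sphere \<Rightarrow> complex^3^3" where
  "g_loop \<alpha> l = (case line_coords l of (a, b) \<Rightarrow> extend_to_sphere (g_formula \<alpha> a b))"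

definition line_star :: "complex \<Rightarrow> (complex^3) set \<Rightarrow> (complex^3) set" where
  "line_star \<alpha> l = line_times (cnj_line l) (matrix_inv (g_loop \<alpha> l (Fin (cnj \<alpha>))))"

definition f_loop :: "complex \<Rightarrow> (complex^3) set \<Rightarrow> riemann_sphere \<Rightarrow> complex^3^3" where
  "f_loop \<alpha> l p = g_loop (cnj \<alpha>) (line_star \<alpha> l) p ** g_loop \<alpha> l p"

end

theory Submission
  imports Defs "HOL-Computational_Algebra.Polynomial"
begin

text \<open>
  Everything reduces to the permutability identity
  \<open>g\<^bsub>\<alpha>,m\<^esub> g\<^bsub>\<beta>,l'\<^esub> = g\<^bsub>\<beta>,l*\<^esub> g\<^bsub>\<alpha>,l\<^esub>\<close>, where \<open>\<beta>\<close>, \<open>l'\<close> and \<open>m\<close> are the conjugates of \<open>\<alpha>\<close>, \<open>l\<close> and \<open>l*\<close>: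
  it is the reality condition for \<open>f\<close>, while the twist is multiplicative and holds for each factor.
  Clear denominators and call the two sides \<open>X\<close> and \<open>Y\<close>. Up to the scalar
  \<open>(z\<^sup>6 - \<alpha>\<^sup>6)(z\<^sup>6 - \<beta>\<^sup>6)\<close> the inverse of \<open>Y(z)\<close> is the polynomial \<open>flip (Y(-z))\<close>, so \<open>X(z) flip (Y(-z))\<close> is a
  matrix polynomial of degree 12 with leading coefficient \<open>I\<close>. At \<open>z = \<alpha>\<close> and \<open>z = \<beta>\<close> it vanishes, because
  the residue of a simple factor has rank one with row space the line, and \<open>l*\<close> is chosen so
  that these lines match up. Exchanging \<open>X\<close> and \<open>Y\<close> gives the zeros \<open>-\<alpha>\<close> and \<open>-\<beta>\<close>, and equivariance under cube roots of unity
  gives all twelve zeros. Twelve zeros are enough only if they are distinct, which is what the condition on the argument of \<open>\<alpha>\<close>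
  ensures. Hence the polynomial is \<open>(z\<^sup>6 - \<alpha>\<^sup>6)(z\<^sup>6 - \<beta>\<^sup>6) I\<close>, so \<open>X = Y\<close>.
\<close>

subsection \<open>The numerator of a simple factor\<close>

text \<open>This is \<open>g_formula\<close> multiplied by \<open>z^3 - \<alpha>^3\<close>. At the
  poles \<open>g_formula\<close> takes only a default value, whereas this polynomial retains the
  residue.\<close>

definition g_num :: "complex \<Rightarrow> complex \<Rightarrow> complex \<Rightarrow> complex \<Rightarrow> complex^3^3" where
  "g_num \<alpha> a b z = vector
     [vector [z^3 - \<alpha>^3 + 2 * \<alpha>^3 * a * b / (2 * a * b - 1),
              2 * \<alpha> * z^2 * b^2 / (2 * a * b - 1),
              2 * \<alpha>^2 * z * b / (2 * a * b - 1)],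
      vector [2 * \<alpha>^2 * z * a^2, z^3 - \<alpha>^3 + 2 * \<alpha>^3 * a * b, 2 * \<alpha> * z^2 * a],
      vector [2 * \<alpha> * z^2 * a, 2 * \<alpha>^2 * z * b, z^3 + \<alpha>^3]]"

text \<open>Gram matrix of the bilinear form \<open>x1 y2 + x2 y1 + x3 y3\<close>;
  \<open>flip\<close> is the adjoint for this form.\<close>

definition swap12 :: "complex^3^3" where
  "swap12 = vector [vector [0, 1, 0], vector [1, 0, 0], vector [0, 0, 1]]"

text \<open>Since \<^term>\<open>eps\<close> is minus a cube root of unity, the twist by \<^term>\<open>sigma\<close> at \<^term>\<open>eps * z\<close> is
  the combination of the condition that \<open>z \<mapsto> flip (g (- z))\<close> inverts \<open>g\<close> with equivariance
  under \<open>z \<mapsto> t * z\<close> for \<open>t^3 = 1\<close>.\<close>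

definition flip :: "complex^3^3 \<Rightarrow> complex^3^3" where
  "flip A = swap12 ** transpose A ** swap12"

definition rot :: "complex \<Rightarrow> complex^3^3" where
  "rot t = vector [vector [1, 0, 0], vector [0, t, 0], vector [0, 0, t^2]]"

lemmas mat3 = vec_eq_iff forall_3 matrix_matrix_mult_def vector_matrix_mult_def sum_3 transpose_def mat_def

lemma swap12_involution: "swap12 ** swap12 = mat 1"
  by (simp add: swap12_def mat3)

lemma flip_flip: "flip (flip A) = A"
  by (simp add: flip_def swap12_def mat3)

lemma flip_mult: "flip (A ** B) = flip B ** flip A"
  by (simp add: flip_def matrix_transpose_mul) (metis matrix_mul_assoc matrix_mul_rid swap12_involution)

lemma flip_0 : "flip 0 = 0"
  by (simp add: flip_def swap12_def mat3)

lemma g_formula_eq_smult_g_num: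
  assumes "z^3 \<noteq> \<alpha>^3"
  shows "g_formula \<alpha> a b z = map_matrix ((*) (1 / (z^3 - \<alpha>^3))) (g_num \<alpha> a b z)"
  using assms by (simp add: g_formula_def g_num_def map_matrix_def mat3 field_simps)

lemma g_num_flip:
  assumes "2 * a * b \<noteq> 1"
  shows "g_num \<alpha> a b z ** flip (g_num \<alpha> a b (- z)) = mat (\<alpha>^6 - z^6)"
proof -
  \<comment> \<open>With \<open>q\<close> for the reciprocal, the entries become polynomial
    identities modulo the relation \<open>q\<close>, within reach of \<open>algebra\<close>.\<close>
  define q where "q = 1 / (2 * a * b - 1)"
  have q: "q * (2 * a * b - 1) = 1" using assms by (simp add: q_def)
  have d: "x / (2 * a * b - 1) = x * q" for x by (simp add: q_def)
  show ?thesis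
    unfolding g_num_def d
    by (simp add: flip_def swap12_def mat3) (intro conjI allI; (algebra | (use q in algebra)))
qed

lemma flip_g_num:
  assumes "2 * a * b \<noteq> 1"
  shows "flip (g_num \<alpha> a b (- z)) ** g_num \<alpha> a b z = mat (\<alpha>^6 - z^6)"
proof -
  define q where "q = 1 / (2 * a * b - 1)"
  have q: "q * (2 * a * b - 1) = 1" using assms by (simp add: q_def)
  have d: "x / (2 * a * b - 1) = x * q" for x by (simp add: q_def)
  show ?thesis
    unfolding g_num_def d
    by (simp add: flip_def swap12_def mat3) (intro conjI allI; (algebra | (use q in algebra)))
qed

text \<open>The third row of \<open>g_num \<alpha> a b \<alpha>\<close> is
  \<open>2 * \<alpha>^3\<close> times \<open>(a, b, 1)\<close>, and at \<open>z = \<alpha>\<close>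
  the product in \<open>g_num_flip\<close> is 0.\<close>

lemma g_num_kernel:
  assumes "2 * a * b \<noteq> 1"
  shows "vector [a, b, 1] v* flip (g_num \<alpha> a b (- \<alpha>)) = 0"
proof -
  define q where "q = 1 / (2 * a * b - 1)"
  have q: "q * (2 * a * b - 1) = 1" using assms by (simp add: q_def)
  have d: "x / (2 * a * b - 1) = x * q" for x by (simp add: q_def)
  show ?thesis
    unfolding g_num_def d
    by (simp add: flip_def swap12_def mat3) (intro conjI allI; (algebra | (use q in algebra)))
qed

text \<open>Every row of \<open>g_num \<alpha> a b \<alpha>\<close> is a multiple of
  \<open>(a, b, 1)\<close>.\<close>

lemma g_num_rank1:
  assumes "vector [a, b, 1] v* N = 0"
  shows "g_num \<alpha> a b \<alpha> ** N = 0"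
proof -
  have "a * N $ 1 $ i + b * N $ 2 $ i + N $ 3 $ i = 0" for i
    using assms by (simp add: mat3)
  then have N3: "N $ 3 $ i = - (a * N $ 1 $ i + b * N $ 2 $ i)" for i
    by (metis add.commute eq_neg_iff_add_eq_0)
  show ?thesis
    by (simp add: g_num_def mat3 N3) (simp add: algebra_simps divide_inverse power2_eq_square power3_eq_cube)
qed

text \<open>Entry (i, j) of \<open>g_num\<close> contains only powers of \<open>z\<close> with
  exponent congruent to i - j modulo 3, and conjugation by \<open>rot t\<close> multiplies that
  entry by t to the power i - j.\<close>

lemma g_num_rot:
  assumes "t^3 = 1"
  shows "g_num \<alpha> a b (t * z) = rot t ** g_num \<alpha> a b z ** rot (t^2)"
  by (simp add: g_num_def rot_def mat3 divide_inverse del: mult_cancel_left mult_cancel_right)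
     (intro conjI; (algebra | (use assms in algebra)))

lemma flip_g_num_rot:
  assumes "t^3 = 1"
  shows "flip (g_num \<alpha> a b (- (t * z))) = rot t ** flip (g_num \<alpha> a b (- z)) ** rot (t^2)"
  by (simp add: g_num_def rot_def flip_def swap12_def mat3 divide_inverse del: mult_cancel_left mult_cancel_right)
     (intro conjI; (algebra | (use assms in algebra)))

lemma rot_inverse:
  assumes "t^3 = 1"
  shows "rot (t^2) ** rot t = mat 1"
  by (simp add: rot_def mat3) (intro conjI; (use assms in algebra))

subsection \<open>Matrix polynomials with scalar leading coefficient\<close>

text \<open>The degree is only bounded by \<open>n\<close>, because the coefficient of degree
  \<open>n\<close> vanishes off the diagonal.\<close>

definition poly_lead :: "nat \<Rightarrow> complex \<Rightarrow> (complex \<Rightarrow> complex^3^3) \<Rightarrow> bool" where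
  "poly_lead n c F \<longleftrightarrow>
     (\<forall>i j. \<exists>p. degree p \<le> n \<and> coeff p n = mat c $ i $ j \<and> (\<forall>z. F z $ i $ j = poly p z))"

lemma coeff_mult_degree_le:
  fixes p q :: "'a::comm_semiring_0 poly"
  assumes "degree p \<le> m" "degree q \<le> n"
  shows "coeff (p * q) (m + n) = coeff p m * coeff q n"
proof -
  have "coeff (p * q) (m + n) = (\<Sum>i\<le>m + n. coeff p i * coeff q (m + n - i))"
    by (rule coeff_mult)
  also have "\<dots> = (\<Sum>i\<in>{m}. coeff p i * coeff q (m + n - i))"
  proof (rule sum.mono_neutral_right)
    show "\<forall>i\<in>{..m + n} - {m}. coeff p i * coeff q (m + n - i) = 0"
    proof
      fix i assume "i \<in> {..m + n} - {m}"
      then have "i > m \<or> m + n - i > n" by auto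
      then have "coeff p i = 0 \<or> coeff q (m + n - i) = 0"
        using assms by (meson coeff_eq_0 le_less_trans)
      then show "coeff p i * coeff q (m + n - i) = 0" by auto
    qed
  qed auto
  finally show ?thesis by simp
qed

lemma poly_lead_mult:
  assumes "poly_lead m c F" and "poly_lead n d G"
  shows "poly_lead (m + n) (c * d) (\<lambda>z. F z ** G z)"
proof -
  obtain p where p: "\<And>i j. degree (p i j) \<le> m" "\<And>i j. coeff (p i j) m = mat c $ i $ j"
      "\<And>i j z. F z $ i $ j = poly (p i j) z"
    using assms(1) unfolding poly_lead_def by metis
  obtain q where q: "\<And>i j. degree (q i j) \<le> n" "\<And>i j. coeff (q i j) n = mat d $ i $ j"
      "\<And>i j z. G z $ i $ j = poly (q i j) z"
    using assms(2) unfolding poly_lead_def by metis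
  show ?thesis
    unfolding poly_lead_def
  proof (intro allI exI conjI)
    fix i j z
    let ?r = "\<Sum>k\<in>UNIV. p i k * q k j"
    show "degree ?r \<le> m + n"
      by (intro degree_sum_le) (auto intro: order_trans[OF degree_mult_le] add_mono p q)
    have "coeff ?r (m + n) = (\<Sum>k\<in>UNIV. mat c $ i $ k * mat d $ k $ j)"
      by (simp add: coeff_sum coeff_mult_degree_le p q)
    also have "\<dots> = mat (c * d) $ i $ j"
      by (simp add: mat_def if_distrib[of "\<lambda>x. x * _"] cong: if_cong)
    finally show "coeff ?r (m + n) = mat (c * d) $ i $ j" .
    show "(F z ** G z) $ i $ j = poly ?r z"
      by (simp add: matrix_matrix_mult_def p q poly_sum)
  qed
qed

lemma poly_lead_cubic:
  assumes "\<And>z i j. F z $ i $ j = mat c $ i $ j * z^3 + K2 $ i $ j * z^2 + K1 $ i $ j * z + K0 $ i $ j"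
  shows "poly_lead 3 c F"
  unfolding poly_lead_def
proof (intro allI)
  fix i j
  let ?p = "[:K0 $ i $ j, K1 $ i $ j, K2 $ i $ j, mat c $ i $ j:]"
  have "degree ?p \<le> 3" by simp
  moreover have "coeff ?p 3 = mat c $ i $ j" by (simp add: numeral_3_eq_3)
  moreover have "\<forall>z. F z $ i $ j = poly ?p z"
    by (simp add: assms algebra_simps power2_eq_square power3_eq_cube)
  ultimately show "\<exists>p. degree p \<le> 3 \<and> coeff p 3 = mat c $ i $ j \<and> (\<forall>z. F z $ i $ j = poly p z)"
    by blast
qed

lemma g_num_coeffs:
  obtains K0 K1 K2 where
    "\<And>z i j. g_num \<alpha> a b z $ i $ j = mat 1 $ i $ j * z^3 + K2 $ i $ j * z^2 + K1 $ i $ j * z + K0 $ i $ j"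
proof -
  define n where "n = 2 * a * b - 1"
  let ?K0 = "vector [vector [2 * \<alpha>^3 * a * b / n - \<alpha>^3, 0, 0],
                     vector [0, 2 * \<alpha>^3 * a * b - \<alpha>^3, 0], vector [0, 0, \<alpha>^3]] :: complex^3^3"
  let ?K1 = "vector [vector [0, 0, 2 * \<alpha>^2 * b / n], vector [2 * \<alpha>^2 * a^2, 0, 0],
                     vector [0, 2 * \<alpha>^2 * b, 0]] :: complex^3^3"
  let ?K2 = "vector [vector [0, 2 * \<alpha> * b^2 / n, 0], vector [0, 0, 2 * \<alpha> * a],
                     vector [2 * \<alpha> * a, 0, 0]] :: complex^3^3"
  have "\<forall>i j. g_num \<alpha> a b z $ i $ j
      = mat 1 $ i $ j * z^3 + ?K2 $ i $ j * z^2 + ?K1 $ i $ j * z + ?K0 $ i $ j" for z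
    unfolding g_num_def n_def[symmetric] by (simp add: forall_3 mat_def)
  with that show thesis by blast
qed

lemma poly_lead_g_num: "poly_lead 3 1 (g_num \<alpha> a b)"
  by (rule g_num_coeffs[of \<alpha> a b]) (rule poly_lead_cubic)

text \<open>The sign comes from \<open>(- z)^3\<close>; two such factors together have leading
  coefficient 1 again.\<close>

lemma poly_lead_flip_g_num: "poly_lead 3 (-1) (\<lambda>z. flip (g_num \<alpha> a b (- z)))"
proof -
  obtain K0 K1 K2 where K:
    "\<And>z i j. g_num \<alpha> a b z $ i $ j = mat 1 $ i $ j * z^3 + K2 $ i $ j * z^2 + K1 $ i $ j * z + K0 $ i $ j"
    by (rule g_num_coeffs[of \<alpha> a b]) blast
  have "\<forall>i j. flip (g_num \<alpha> a b (- z)) $ i $ j = mat (-1) $ i $ j * z^3 + flip K2 $ i $ j * z^2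
      + (- flip K1) $ i $ j * z + flip K0 $ i $ j" for z
    by (simp add: K flip_def swap12_def forall_3 matrix_matrix_mult_def sum_3 transpose_def mat_def)
  then show ?thesis by (intro poly_lead_cubic) blast
qed

lemma poly_lead_12_eqI:
  assumes F: "poly_lead 12 1 F"
    and nz: "\<alpha> \<noteq> 0" "\<beta> \<noteq> 0" "\<alpha>^6 \<noteq> \<beta>^6"
    and zero: "\<And>z. z^6 = \<alpha>^6 \<or> z^6 = \<beta>^6 \<Longrightarrow> F z = 0"
  shows "F z = mat ((z^6 - \<alpha>^6) * (z^6 - \<beta>^6))"
proof -
  let ?A = "{z. z^6 = \<alpha>^6} \<union> {z. z^6 = \<beta>^6}"
  have fin: "finite {z::complex. z^6 = c}" for c
    using finite_nth_roots[of 6] by simp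
  \<comment> \<open>Six roots each, since \<open>\<alpha>\<close> and \<open>\<beta>\<close> are
    nonzero, and none in common, since their sixth powers differ.\<close>
  have card: "card ?A = 12"
    using nz by (subst card_Un_disjoint) (auto simp: fin card_nth_roots)
  define q where "q = [:\<alpha>^6 * \<beta>^6, 0, 0, 0, 0, 0, - (\<alpha>^6 + \<beta>^6), 0, 0, 0, 0, 0, 1:]"
  have poly_q: "poly q x = (x^6 - \<alpha>^6) * (x^6 - \<beta>^6)" for x
    unfolding q_def by simp algebra
  have deg_q: "degree q \<le> 12" and coeff_q: "coeff q 12 = 1"
    by (simp_all add: q_def eval_nat_numeral)
  have "F z $ i $ j = mat ((z^6 - \<alpha>^6) * (z^6 - \<beta>^6)) $ i $ j" for i j
  proof -
    obtain p where p: "degree p \<le> 12" "coeff p 12 = mat 1 $ i $ j" "\<And>z. F z $ i $ j = poly p z"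
      using F unfolding poly_lead_def by metis
    \<comment> \<open>The factor \<open>mat 1 $ i $ j\<close> is 1 or 0, which treats diagonal and
      off-diagonal entries at once. The difference has degree below 12 but vanishes on
      \<open>?A\<close>.\<close>
    define r where "r = p - smult (mat 1 $ i $ j) q"
    have "degree r \<le> 12"
      unfolding r_def using p(1) deg_q by (intro degree_diff_le) (auto intro: order_trans[OF degree_smult_le])
    moreover have "coeff r 12 = 0"
      by (simp add: r_def p(2) coeff_q)
    ultimately have deg_r: "r = 0 \<or> degree r < 12"
      by (metis leading_coeff_0_iff le_neq_implies_less)
    have "r = 0"
    proof (rule ccontr)
      assume "r \<noteq> 0"
      have "?A \<subseteq> {x. poly r x = 0}"
      proof
        fix x assume "x \<in> ?A"
        then have "F x = 0" "poly q x = 0" using zero[of x] by (auto simp: poly_q)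
        then show "x \<in> {x. poly r x = 0}" using p(3)[of x] by (simp add: r_def)
      qed
      then have "card ?A \<le> degree r"
        using card_mono[OF poly_roots_finite[OF \<open>r \<noteq> 0\<close>]] card_poly_roots_bound[OF \<open>r \<noteq> 0\<close>]
          order_trans by blast
      with deg_r \<open>r \<noteq> 0\<close> card show False by simp
    qed
    then have "poly p z = mat 1 $ i $ j * poly q z"
      by (simp add: r_def)
    then show ?thesis
      by (simp add: p(3) poly_q mat_def)
  qed
  then show ?thesis by (simp add: vec_eq_iff)
qed

subsection \<open>Permutability\<close>

lemma mat_mult_nth:
  fixes A :: "'a::comm_semiring_1^'n^'m"
  shows "(mat c ** A) $ i $ j = c * A $ i $ j"
  by (simp add: matrix_matrix_mult_def mat_def if_distrib[of "\<lambda>x. x * _"] cong: if_cong)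

lemma mult_mat_nth:
  fixes A :: "'a::comm_semiring_1^'n^'m"
  shows "(A ** mat c) $ i $ j = A $ i $ j * c"
  by (simp add: matrix_matrix_mult_def mat_def if_distrib[of "\<lambda>x. _ * x"] cong: if_cong)

lemma mat_mult_commute: "A ** mat c = mat c ** A" for A :: "'a::comm_semiring_1^'n^'n"
  by (simp add: vec_eq_iff mat_mult_nth mult_mat_nth mult.commute)

lemma mat_mult_mat: "mat c ** mat d = (mat (c * d) :: 'a::comm_semiring_1^'n^'n)"
  by (simp add: vec_eq_iff mat_mult_nth) (simp add: mat_def)

lemma vector_mat: "v v* mat c = c *s v" for v :: "'a::comm_semiring_1^'n"
  by (simp add: vec_eq_iff vector_matrix_mult_def mat_def if_distrib[of "\<lambda>x. _ * x"] mult.commute cong: if_cong)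

text \<open>At \<open>\<alpha>\<close> the leftmost factor has its rows on the line of
  \<open>(a1, b1, 1)\<close>, which \<open>R1\<close> carries into the kernel from
  \<open>g_num_kernel\<close>. At \<open>\<beta>\<close> the second factor has its rows on the line
  of \<open>(c, d, 1)\<close>, and \<open>R2\<close>, read through the inverse of
  \<open>g_num \<alpha> a b \<beta>\<close>, carries that line to the one of
  \<open>(a2, b2, 1)\<close>.\<close>

lemma product_zeros:
  assumes ab: "2 * a * b \<noteq> 1" and cd: "2 * a2 * b2 \<noteq> 1"
    and ne: "\<alpha>^6 \<noteq> \<beta>^6"
    and R1: "vector [a1, b1, 1] v* g_num \<beta> c d \<alpha> = k1 *s vector [a, b, 1]"
    and R2: "vector [a2, b2, 1] v* g_num \<alpha> a b \<beta> = k2 *s vector [c, d, 1]"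
  shows "g_num \<alpha> a1 b1 \<alpha> ** g_num \<beta> c d \<alpha> ** flip (g_num \<beta> a2 b2 (- \<alpha>) ** g_num \<alpha> a b (- \<alpha>)) = 0"
    and "g_num \<alpha> a1 b1 \<beta> ** g_num \<beta> c d \<beta> ** flip (g_num \<beta> a2 b2 (- \<beta>) ** g_num \<alpha> a b (- \<beta>)) = 0"
proof -
  have "vector [a1, b1, 1] v* (g_num \<beta> c d \<alpha> ** (flip (g_num \<alpha> a b (- \<alpha>)) ** flip (g_num \<beta> a2 b2 (- \<alpha>)))) = 0"
    by (simp add: vector_matrix_mul_assoc[symmetric] R1 scalar_vector_matrix_assoc g_num_kernel ab)
  then show "g_num \<alpha> a1 b1 \<alpha> ** g_num \<beta> c d \<alpha> ** flip (g_num \<beta> a2 b2 (- \<alpha>) ** g_num \<alpha> a b (- \<alpha>)) = 0"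
    by (simp add: flip_mult matrix_mul_assoc[symmetric] g_num_rank1)
  let ?w = "vector [c, d, 1] v* flip (g_num \<alpha> a b (- \<beta>))"
  have "(vector [a2, b2, 1] v* g_num \<alpha> a b \<beta>) v* flip (g_num \<alpha> a b (- \<beta>)) = (\<alpha>^6 - \<beta>^6) *s vector [a2, b2, 1]"
    by (simp add: vector_matrix_mul_assoc g_num_flip ab vector_mat)
  then have w: "k2 *s ?w = (\<alpha>^6 - \<beta>^6) *s vector [a2, b2, 1]"
    by (simp add: R2 scalar_vector_matrix_assoc)
  \<comment> \<open>The third component of \<open>(a2, b2, 1)\<close> is 1, so comparing third
    components rules out \<open>k2 = 0\<close>.\<close>
  then have "k2 * ?w $ 3 = \<alpha>^6 - \<beta>^6"
    by (simp add: vec_eq_iff forall_3)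
  with ne have "k2 \<noteq> 0" by auto
  have "k2 *s (?w v* flip (g_num \<beta> a2 b2 (- \<beta>))) = (k2 *s ?w) v* flip (g_num \<beta> a2 b2 (- \<beta>))"
    by (rule scalar_vector_matrix_assoc[symmetric])
  also have "\<dots> = 0"
    unfolding w scalar_vector_matrix_assoc g_num_kernel[OF cd] by simp
  finally have "k2 *s (?w v* flip (g_num \<beta> a2 b2 (- \<beta>))) = 0" .
  with \<open>k2 \<noteq> 0\<close> have "?w v* flip (g_num \<beta> a2 b2 (- \<beta>)) = 0"
    by simp
  then have "g_num \<beta> c d \<beta> ** (flip (g_num \<alpha> a b (- \<beta>)) ** flip (g_num \<beta> a2 b2 (- \<beta>))) = 0"
    by (intro g_num_rank1) (simp add: vector_matrix_mul_assoc)
  then show "g_num \<alpha> a1 b1 \<beta> ** g_num \<beta> c d \<beta> ** flip (g_num \<beta> a2 b2 (- \<beta>) ** g_num \<alpha> a b (- \<beta>)) = 0"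
    by (simp add: flip_mult matrix_mul_assoc[symmetric])
qed

text \<open>The sixth roots of unity are the cube roots of unity and their negatives, so
  equivariance under cube roots reduces the twelve zeros to \<open>\<alpha>\<close>,
  \<open>\<beta>\<close> and their negatives.\<close>

lemma sixth_power_eqE:
  fixes z w :: complex
  assumes "z^6 = w^6" and "w \<noteq> 0"
  obtains t where "t^3 = 1" "z = t * w" | t where "t^3 = 1" "z = t * - w"
proof -
  define t where "t = z / w"
  have z: "z = t * w" using assms(2) by (simp add: t_def)
  have "t^6 = 1" using assms by (simp add: t_def power_divide)
  then have "(t^3 - 1) * (t^3 + 1) = 0" by algebra
  then consider "t^3 = 1" | "(- t)^3 = 1"
    by (auto simp: eq_neg_iff_add_eq_0[symmetric])
  then show thesis
    using that[of t] that(2)[of "- t"] z by cases simp_all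
qed

lemma rot_conj_mult:
  assumes "t^3 = 1"
  shows "(rot t ** A ** rot (t^2)) ** (rot t ** B ** rot (t^2)) = rot t ** (A ** B) ** rot (t^2)"
proof -
  have "(rot t ** A ** rot (t^2)) ** (rot t ** B ** rot (t^2))
      = rot t ** A ** (rot (t^2) ** rot t) ** B ** rot (t^2)"
    by (simp only: matrix_mul_assoc)
  then show ?thesis
    by (simp add: rot_inverse[OF assms] matrix_mul_assoc)
qed

lemma g_num_permutability:
  assumes nd: "2 * a * b \<noteq> 1" "2 * c * d \<noteq> 1" "2 * a1 * b1 \<noteq> 1" "2 * a2 * b2 \<noteq> 1"
    and nz: "\<alpha> \<noteq> 0" "\<beta> \<noteq> 0" and ne: "\<alpha>^6 \<noteq> \<beta>^6"
    and R1: "vector [a1, b1, 1] v* g_num \<beta> c d \<alpha> = k1 *s vector [a, b, 1]"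
    and R2: "vector [a2, b2, 1] v* g_num \<alpha> a b \<beta> = k2 *s vector [c, d, 1]"
    and z: "z^6 \<noteq> \<alpha>^6" "z^6 \<noteq> \<beta>^6"
  shows "g_num \<alpha> a1 b1 z ** g_num \<beta> c d z = g_num \<beta> a2 b2 z ** g_num \<alpha> a b z"
proof -
  define X where "X z = g_num \<alpha> a1 b1 z ** g_num \<beta> c d z" for z
  define Y where "Y z = g_num \<beta> a2 b2 z ** g_num \<alpha> a b z" for z
  define \<Phi> where "\<Phi> z = X z ** flip (Y (- z))" for z
  have \<Phi>: "\<Phi> z = g_num \<alpha> a1 b1 z ** g_num \<beta> c d z ** (flip (g_num \<alpha> a b (- z)) ** flip (g_num \<beta> a2 b2 (- z)))" for z
    by (simp add: \<Phi>_def X_def Y_def flip_mult)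
  have lead: "poly_lead 12 1 \<Phi>"
    using poly_lead_mult[OF poly_lead_mult[OF poly_lead_g_num[of \<alpha> a1 b1] poly_lead_g_num[of \<beta> c d]]
        poly_lead_mult[OF poly_lead_flip_g_num[of \<alpha> a b] poly_lead_flip_g_num[of \<beta> a2 b2]]]
    unfolding \<Phi>[abs_def] by simp
  have rot: "\<Phi> (t * z) = rot t ** \<Phi> z ** rot (t^2)" if t: "t^3 = 1" for t z
    unfolding \<Phi> g_num_rot[OF t] flip_g_num_rot[OF t] rot_conj_mult[OF t] ..
  have pos: "\<Phi> \<alpha> = 0" "\<Phi> \<beta> = 0"
    unfolding \<Phi>_def X_def Y_def by (rule product_zeros[OF nd(1,4) ne R1 R2])+
  \<comment> \<open>Exchanging \<open>\<alpha>\<close> with \<open>\<beta>\<close> and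
    \<open>R1\<close> with \<open>R2\<close> exchanges \<open>X\<close> with \<open>Y\<close>. Since
    \<open>flip\<close> is an involution reversing products, the zeros of the exchanged product
    become zeros of \<open>\<Phi>\<close> at the negatives.\<close>
  have "Y \<beta> ** flip (X (- \<beta>)) = 0" "Y \<alpha> ** flip (X (- \<alpha>)) = 0"
    unfolding X_def Y_def by (rule product_zeros[OF nd(2,3) ne[symmetric] R2 R1])+
  moreover have "\<Phi> (- w) = flip (Y w ** flip (X (- w)))" for w
    by (simp add: \<Phi>_def flip_mult flip_flip)
  ultimately have neg: "\<Phi> (- \<alpha>) = 0" "\<Phi> (- \<beta>) = 0"
    by (simp_all add: flip_0)
  have zero: "\<Phi> w = 0" if "w^6 = \<alpha>^6 \<or> w^6 = \<beta>^6" for w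
  proof -
    have "\<Phi> w = 0" if "w^6 = v^6" "v \<noteq> 0" "\<Phi> v = 0" "\<Phi> (- v) = 0" for v
      using that(1,2)
    proof (cases rule: sixth_power_eqE)
      case (1 t)
      then show ?thesis using rot[of t v] that(3) by simp
    next
      case (2 t)
      then show ?thesis using rot[of t "- v"] that(4) by simp
    qed
    from that this[of \<alpha>] this[of \<beta>] pos neg nz show ?thesis by blast
  qed
  define s where "s = (z^6 - \<alpha>^6) * (z^6 - \<beta>^6)"
  have "s \<noteq> 0" using z by (simp add: s_def)
  have "X z ** flip (Y (- z)) = mat s"
    using poly_lead_12_eqI[OF lead nz ne zero, of z] unfolding \<Phi>_def s_def .
  \<comment> \<open>Both \<open>X z\<close> and \<open>Y z\<close> are inverse to
    \<open>flip (Y (- z))\<close> up to the same nonzero scalar \<open>s\<close>, hence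
    equal.\<close>
  moreover have "flip (Y (- z)) ** Y z = mat s"
  proof -
    have "flip (Y (- z)) ** Y z = flip (g_num \<alpha> a b (- z)) ** mat (\<beta>^6 - z^6) ** g_num \<alpha> a b z"
      unfolding Y_def flip_mult flip_g_num[OF nd(4), of \<beta> z, symmetric] by (simp add: matrix_mul_assoc)
    also have "\<dots> = mat (\<beta>^6 - z^6) ** mat (\<alpha>^6 - z^6)"
      unfolding mat_mult_commute[of "flip (g_num \<alpha> a b (- z))"] flip_g_num[OF nd(1), of \<alpha> z, symmetric]
      by (simp add: matrix_mul_assoc)
    also have "\<dots> = mat s"
      unfolding mat_mult_mat s_def by (simp add: algebra_simps)
    finally show ?thesis .
  qed
  ultimately have "mat s ** Y z = X z ** mat s"
    using matrix_mul_assoc[of "X z" "flip (Y (- z))" "Y z"] by simp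
  then have "mat s ** X z = mat s ** Y z"
    by (simp only: mat_mult_commute)
  then have "X z = Y z"
    using \<open>s \<noteq> 0\<close> by (simp add: vec_eq_iff mat_mult_nth)
  then show ?thesis
    by (simp add: X_def Y_def)
qed

section \<open>From numerators back to the simple factors\<close>

lemma smult_mult_left:
  fixes A :: "'a::comm_semiring_1^'n^'m" and B :: "'a^'k^'n"
  shows "map_matrix ((*) k) A ** B = map_matrix ((*) k) (A ** B)"
  by (simp add: map_matrix_def matrix_matrix_mult_def vec_eq_iff sum_distrib_left mult.assoc)

lemma smult_mult_right:
  fixes A :: "'a::comm_semiring_1^'n^'m" and B :: "'a^'k^'n"
  shows "A ** map_matrix ((*) k) B = map_matrix ((*) k) (A ** B)"
  by (simp add: map_matrix_def matrix_matrix_mult_def vec_eq_iff sum_distrib_left mult.left_commute)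

lemma smult_smult:
  fixes A :: "'a::semigroup_mult^'n^'m"
  shows "map_matrix ((*) k) (map_matrix ((*) l) A) = map_matrix ((*) (k * l)) A"
  by (simp add: map_matrix_def vec_eq_iff mult.assoc)

lemma flip_smult: "flip (map_matrix ((*) k) A) = map_matrix ((*) k) (flip A)"
  by (simp add: flip_def swap12_def map_matrix_def mat3)

text \<open>The two denominators multiply to \<open>\<alpha>^6 - z^6\<close>, exactly the scalar in
  \<open>g_num_flip\<close>.\<close>

lemma g_flip:
  assumes "2 * a * b \<noteq> 1" and "z^6 \<noteq> \<alpha>^6"
  shows "g_formula \<alpha> a b z ** flip (g_formula \<alpha> a b (- z)) = mat 1"
    and "flip (g_formula \<alpha> a b (- z)) ** g_formula \<alpha> a b z = mat 1"
proof -
  have *: "\<alpha>^6 - z^6 = (z^3 - \<alpha>^3) * ((- z)^3 - \<alpha>^3)" by simp algebra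
  with assms(2) have nz: "z^3 \<noteq> \<alpha>^3" "(- z)^3 \<noteq> \<alpha>^3" by auto
  have "map_matrix ((*) (1 / (z^3 - \<alpha>^3) * (1 / ((- z)^3 - \<alpha>^3)))) (mat (\<alpha>^6 - z^6)) = (mat 1 :: complex^3^3)"
    using nz unfolding * by (auto simp: vec_eq_iff map_matrix_def mat_def)
  then show "g_formula \<alpha> a b z ** flip (g_formula \<alpha> a b (- z)) = mat 1"
    unfolding g_formula_eq_smult_g_num[OF nz(1)] g_formula_eq_smult_g_num[OF nz(2)] flip_smult
      smult_mult_left smult_mult_right smult_smult g_num_flip[OF assms(1)] by (simp add: mult.commute)
  then show "flip (g_formula \<alpha> a b (- z)) ** g_formula \<alpha> a b z = mat 1"
    by (simp add: matrix_left_right_inverse)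
qed

lemma g_invertible:
  assumes "2 * a * b \<noteq> 1" and "z^6 \<noteq> \<alpha>^6"
  shows "invertible (g_formula \<alpha> a b z)"
  using g_flip[OF assms] invertible_def by blast

text \<open>Denominators only rescale \<open>k1\<close> and \<open>k2\<close>, and both sides of the
  conclusion carry the same ones.\<close>

lemma g_permutability:
  assumes nd: "2 * a * b \<noteq> 1" "2 * c * d \<noteq> 1" "2 * a1 * b1 \<noteq> 1" "2 * a2 * b2 \<noteq> 1"
    and nz: "\<alpha> \<noteq> 0" "\<beta> \<noteq> 0" and ne: "\<alpha>^6 \<noteq> \<beta>^6"
    and R1: "vector [a1, b1, 1] v* g_formula \<beta> c d \<alpha> = k1 *s vector [a, b, 1]"
    and R2: "vector [a2, b2, 1] v* g_formula \<alpha> a b \<beta> = k2 *s vector [c, d, 1]"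
    and z: "z^6 \<noteq> \<alpha>^6" "z^6 \<noteq> \<beta>^6"
  shows "g_formula \<alpha> a1 b1 z ** g_formula \<beta> c d z = g_formula \<beta> a2 b2 z ** g_formula \<alpha> a b z"
proof -
  have cube: "x^3 \<noteq> y^3" if "x^6 \<noteq> y^6" for x y :: complex
    using that by (metis numeral_Bit0 power_add)
  have num_eq: "g_num \<gamma> p q x = map_matrix ((*) (x^3 - \<gamma>^3)) (g_formula \<gamma> p q x)"
    if "x^6 \<noteq> \<gamma>^6" for \<gamma> p q x
    using cube[OF that] by (simp add: g_formula_eq_smult_g_num smult_smult) (simp add: map_matrix_def vec_eq_iff)
  have vm: "v v* map_matrix ((*) k) A = k *s (v v* A)" for v :: "complex^3" and k and A :: "complex^3^3"
    by (simp add: map_matrix_def mat3 algebra_simps)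
  have R1': "vector [a1, b1, 1] v* g_num \<beta> c d \<alpha> = ((\<alpha>^3 - \<beta>^3) * k1) *s vector [a, b, 1]"
    by (simp add: num_eq[OF ne] vm R1)
  have R2': "vector [a2, b2, 1] v* g_num \<alpha> a b \<beta> = ((\<beta>^3 - \<alpha>^3) * k2) *s vector [c, d, 1]"
    by (simp add: num_eq[OF ne[symmetric]] vm R2)
  show ?thesis
    using g_num_permutability[OF nd nz ne R1' R2' z]
    unfolding g_formula_eq_smult_g_num[OF cube[OF z(1)]] g_formula_eq_smult_g_num[OF cube[OF z(2)]]
      smult_mult_left smult_mult_right smult_smult
    by (simp add: mult.commute)
qed

lemma g_rot:
  assumes "t^3 = 1"
  shows "g_formula \<alpha> a b (t * z) = rot t ** g_formula \<alpha> a b z ** rot (t^2)"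
proof -
  have t: "(t * z)^3 = z^3" using assms by (simp add: power_mult_distrib)
  show ?thesis
  proof (cases "z^3 = \<alpha>^3")
    case True
    have "rot t ** rot (t^2) = mat 1"
      using rot_inverse[OF assms] by (simp add: matrix_left_right_inverse)
    \<comment> \<open>Division by zero gives 0, so the formula has the value \<open>mat 1\<close> at
      its poles and the identity holds there as well.\<close>
    moreover have "g_formula \<alpha> a b x = mat 1" if "x^3 = \<alpha>^3" for x
      by (simp add: g_formula_def that map_matrix_def vec_eq_iff)
    ultimately show ?thesis using True t by simp
  next
    case False
    then show ?thesis
      using t g_num_rot[OF assms, of \<alpha> a b z]
      by (simp add: g_formula_eq_smult_g_num smult_mult_left smult_mult_right)
  qed
qed

subsection \<open>The twist, the reality condition and the point at infinity\<close>

lemma eps_cube: "eps^3 = -1"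
proof -
  have "eps^3 = exp (of_real pi * \<i>)"
    unfolding eps_def by (simp flip: exp_of_nat_mult)
  then show ?thesis by (simp add: exp_eq_polar)
qed

lemma matrix_inv_eqI:
  fixes A B :: "'a::field^'n^'n"
  assumes "A ** B = mat 1"
  shows "matrix_inv A = B"
proof -
  have "B ** A = mat 1" using assms by (simp add: matrix_left_right_inverse)
  then have "A ** matrix_inv A = mat 1"
    unfolding matrix_inv_def using assms by (metis (mono_tags, lifting) someI_ex)
  then have "B ** A ** matrix_inv A = B"
    by (metis matrix_mul_assoc matrix_mul_rid)
  then show ?thesis using \<open>B ** A = mat 1\<close> by simp
qed

text \<open>\<open>T_mat\<close> factors as \<open>rot (- eps) ** swap12\<close>, and
  \<open>- eps\<close> is a cube root of unity.\<close>

lemma sigma_eq: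
  assumes "A ** B = mat 1"
  shows "sigma A = rot (- eps) ** flip B ** rot ((- eps)^2)"
proof -
  have e: "eps \<noteq> 0" by (simp add: eps_def)
  have AB: "transpose A ** transpose B = mat 1"
    using assms matrix_left_right_inverse[of A B] by (metis matrix_transpose_mul transpose_mat)
  have "T_mat ** (swap12 ** rot ((- eps)^2)) = mat 1"
    using eps_cube by (simp add: T_mat_def swap12_def rot_def mat3) algebra
  then have "matrix_inv T_mat = swap12 ** rot ((- eps)^2)"
    by (rule matrix_inv_eqI)
  moreover have "T_mat = rot (- eps) ** swap12"
    by (simp add: T_mat_def swap12_def rot_def mat3)
  ultimately show ?thesis
    unfolding sigma_def matrix_inv_eqI[OF AB] flip_def by (simp add: matrix_mul_assoc)
qed

text \<open>The inverse at \<open>z\<close> is \<open>flip\<close> of the factor at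
  \<open>- z\<close>; a second \<open>flip\<close> undoes the first, and rotating by
  \<open>- eps\<close> turns \<open>- z\<close> into \<open>eps * z\<close>.\<close>

lemma sigma_g:
  assumes "2 * a * b \<noteq> 1" and "z^6 \<noteq> \<alpha>^6"
  shows "sigma (g_formula \<alpha> a b z) = g_formula \<alpha> a b (eps * z)"
proof -
  have "(- eps)^3 = 1" by (simp add: eps_cube)
  from g_rot[OF this, of \<alpha> a b "- z"] show ?thesis
    by (simp add: sigma_eq[OF g_flip(1)[OF assms]] flip_flip)
qed

text \<open>Inversion and \<open>flip\<close> each reverse products, so together they keep the
  order.\<close>

lemma sigma_mult:
  assumes "invertible A" "invertible B"
  shows "sigma (A ** B) = sigma A ** sigma B"
proof -
  obtain A' B' where A: "A ** A' = mat 1" and B: "B ** B' = mat 1"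
    using assms invertible_right_inverse by blast
  have "A ** B ** (B' ** A') = mat 1"
    using A B by (metis matrix_mul_assoc matrix_mul_rid)
  then have "sigma (A ** B) = rot (- eps) ** (flip A' ** flip B') ** rot ((- eps)^2)"
    by (simp add: sigma_eq flip_mult)
  also have "\<dots> = sigma A ** sigma B"
    unfolding sigma_eq[OF A] sigma_eq[OF B] by (rule rot_conj_mult[symmetric]) (simp add: eps_cube)
  finally show ?thesis .
qed

lemma sigma_mat_1: "sigma (mat 1) = mat 1"
proof -
  have "sigma (mat 1) = rot (- eps) ** rot ((- eps)^2)"
    by (simp add: sigma_eq[of _ "mat 1"] flip_def swap12_involution transpose_mat)
  then show ?thesis
    using rot_inverse[of "- eps"] by (simp add: eps_cube matrix_left_right_inverse)
qed

lemma cnj_matrix_mult: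
  fixes A :: "complex^'n^'m" and B :: "complex^'k^'n"
  shows "map_matrix cnj (A ** B) = map_matrix cnj A ** map_matrix cnj B"
  by (simp add: map_matrix_def matrix_matrix_mult_def vec_eq_iff)

lemma cnj_g: "map_matrix cnj (g_formula \<alpha> a b z) = g_formula (cnj \<alpha>) (cnj a) (cnj b) (cnj z)"
  by (simp add: g_formula_def map_matrix_def mat3)

section \<open>Holomorphy and the value at infinity\<close>

text \<open>\<^term>\<open>g_formula\<close> in the coordinate \<open>w = 1 / z\<close>, with denominators cleared so that it is defined at 0.\<close>

definition g_chart :: "complex \<Rightarrow> complex \<Rightarrow> complex \<Rightarrow> complex \<Rightarrow> complex^3^3" where
  "g_chart \<alpha> a b w = mat 1 + map_matrix ((*) (2 / (1 - \<alpha>^3 * w^3)))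
     (vector
       [vector [\<alpha>^3 * w^3 * a * b / (2 * a * b - 1),
                \<alpha> * w * b^2 / (2 * a * b - 1),
                \<alpha>^2 * w^2 * b / (2 * a * b - 1)],
        vector [\<alpha>^2 * w^2 * a^2, \<alpha>^3 * w^3 * a * b, \<alpha> * w * a],
        vector [\<alpha> * w * a, \<alpha>^2 * w^2 * b, \<alpha>^3 * w^3]])"

lemma g_formula_inverse:
  assumes "w \<noteq> 0"
  shows "g_formula \<alpha> a b (1 / w) = g_chart \<alpha> a b w"
proof -
  have "(1 / w)^3 - \<alpha>^3 = (1 - \<alpha>^3 * w^3) / w^3"
    using assms by (simp add: field_simps)
  then have f: "2 / ((1 / w)^3 - \<alpha>^3) = 2 / (1 - \<alpha>^3 * w^3) * w^3"
    by simp
  show ?thesis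
    unfolding g_formula_def g_chart_def f using assms
    by (simp add: map_matrix_def mat3 divide_inverse power2_eq_square power3_eq_cube)
       (simp add: field_simps)
qed

lemma g_chart_holomorphic:
  assumes "\<And>w. w \<in> S \<Longrightarrow> \<alpha>^3 * w^3 \<noteq> 1"
  shows "(\<lambda>w. g_chart \<alpha> a b w $ i $ j) holomorphic_on S"
proof -
  have "\<forall>i j. (\<lambda>w. g_chart \<alpha> a b w $ i $ j) holomorphic_on S"
    \<comment> \<open>Division by the constant becomes multiplication by a constant, so the only
      denominator to check is \<open>1 - \<alpha>^3 * w^3\<close>.\<close>
    unfolding forall_3 g_chart_def divide_inverse[of _ "2 * a * b - 1"]
    using assms by (auto simp: map_matrix_def mat_def intro!: holomorphic_intros)
  then show ?thesis by blast
qed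

lemma g_formula_holomorphic:
  assumes "\<And>z. z \<in> S \<Longrightarrow> z^3 \<noteq> \<alpha>^3"
  shows "(\<lambda>z. g_formula \<alpha> a b z $ i $ j) holomorphic_on S"
proof -
  have "\<forall>i j. (\<lambda>w. g_formula \<alpha> a b w $ i $ j) holomorphic_on S"
    unfolding forall_3 g_formula_def divide_inverse[of _ "2 * a * b - 1"]
    using assms by (auto simp: map_matrix_def mat_def intro!: holomorphic_intros)
  then show ?thesis by blast
qed

text \<open>Under \<open>w = 1 / z\<close> the limit at infinity becomes the limit of
  \<open>g_chart\<close> at 0, where holomorphy gives continuity.\<close>

lemma g_at_Infty: "extend_to_sphere (g_formula \<alpha> a b) Infty = mat 1"
proof -
  define S where "S = {w. \<alpha>^3 * w^3 \<noteq> 1}"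
  have "open S"
    unfolding S_def by (intro open_Collect_neq continuous_intros)
  have "((\<lambda>w. g_chart \<alpha> a b w $ i $ j) \<longlongrightarrow> g_chart \<alpha> a b 0 $ i $ j) (at 0)" for i j
    using holomorphic_on_imp_continuous_on[OF g_chart_holomorphic[of S \<alpha> a b i j]] \<open>open S\<close>
    by (auto simp: S_def continuous_on_eq_continuous_at isCont_def)
  then have "(g_chart \<alpha> a b \<longlongrightarrow> g_chart \<alpha> a b 0) (at 0)"
    by (intro vec_tendstoI)
  moreover have "LIM z at_infinity. inverse z :> at (0::complex)"
    by (simp add: filterlim_inverse_at_iff filterlim_ident)
  ultimately have "((\<lambda>z. g_chart \<alpha> a b (inverse z)) \<longlongrightarrow> g_chart \<alpha> a b 0) at_infinity"
    by (rule filterlim_compose)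
  then have "(g_formula \<alpha> a b \<longlongrightarrow> g_chart \<alpha> a b 0) at_infinity"
  proof (rule Lim_transform_eventually)
    show "\<forall>\<^sub>F z in at_infinity. g_chart \<alpha> a b (inverse z) = g_formula \<alpha> a b z"
      using eventually_not_equal_at_infinity[of 0]
      by eventually_elim (simp add: inverse_eq_divide flip: g_formula_inverse)
  qed
  moreover have "g_chart \<alpha> a b 0 = mat 1"
    by (simp add: g_chart_def map_matrix_def mat3)
  ultimately have "(g_formula \<alpha> a b \<longlongrightarrow> mat 1) at_infinity"
    by simp
  then show ?thesis
    using tendsto_Lim[OF trivial_limit_at_infinity] by simp
qed

subsection \<open>Lines\<close>

text \<open>Equality would make \<open>\<alpha>^6\<close> real and hence
  \<open>6 * Arg \<alpha>\<close> a multiple of \<open>pi\<close>, but the hypothesis places it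
  strictly between consecutive multiples.\<close>

lemma sixth_power_cnj:
  assumes "\<alpha> \<noteq> 0" and "Arg \<alpha> \<in> {0<..<pi/6} \<union> {pi/6<..<pi/3}"
  shows "\<alpha>^6 \<noteq> cnj \<alpha>^6"
proof
  assume "\<alpha>^6 = cnj \<alpha>^6"
  then have "Im (\<alpha>^6) = 0"
    by (metis complex_cnj_power Reals_cnj_iff complex_is_Real_iff)
  moreover have "\<alpha>^6 = rcis (norm \<alpha> ^ 6) (6 * Arg \<alpha>)"
    using DeMoivre2[of "norm \<alpha>" "Arg \<alpha>" 6] by (simp add: rcis_cmod_Arg)
  ultimately have "sin (6 * Arg \<alpha>) = 0"
    using assms(1) by simp
  then obtain k :: int where k: "6 * Arg \<alpha> = of_int k * pi"
    by (auto simp: sin_zero_iff_int2)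
  have "of_int k * pi \<in> {0<..<pi} \<union> {pi<..<2 * pi}"
    using assms(2) unfolding k[symmetric] by auto
  then have "0 < k \<and> k < 1 \<or> 1 < k \<and> k < 2"
    by (auto simp: zero_less_mult_iff)
  then show False by linarith
qed

lemma row_line_smult:
  assumes "k \<noteq> 0"
  shows "row_line (k *s v) = row_line v"
proof -
  have "row_line (c *s w) \<subseteq> row_line w" for c and w :: "complex^3"
    by (auto simp: row_line_def vector_smult_assoc)
  from this[of k v] this[of "1 / k" "k *s v"] show ?thesis
    using assms by (simp add: vector_smult_assoc)
qed

lemma line_times_row_line: "line_times (row_line v) A = row_line (v v* A)"
  by (auto simp: line_times_def row_line_def image_def) (metis scalar_vector_matrix_assoc)+

lemma cnj_line_row_line: "cnj_line (row_line v) = row_line (\<chi> i. cnj (v $ i))"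
proof -
  let ?w = "\<chi> i. cnj (v $ i)"
  have "(\<chi> i. cnj ((c *s v) $ i)) = cnj c *s ?w" for c
    by (simp add: vec_eq_iff)
  then have "cnj_line (row_line v) = (\<lambda>c. c *s ?w) ` range cnj"
    by (simp add: cnj_line_def row_line_def full_SetCompr_eq image_image)
  also have "range cnj = UNIV"
    by (rule surjI[of cnj cnj]) simp
  finally show ?thesis
    by (simp add: row_line_def full_SetCompr_eq)
qed

text \<open>Both equations defining \<open>Delta\<close> are homogeneous, so the spanning vector
  decides.\<close>

lemma row_line_subset_Delta_iff:
  "row_line v \<subseteq> Delta \<longleftrightarrow> 2 * v $ 1 * v $ 2 = (v $ 3)^2 \<or> v $ 3 = 0"
proof
  assume "row_line v \<subseteq> Delta"
  moreover have "v \<in> row_line v"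
    unfolding row_line_def by (auto intro: exI[of _ 1])
  ultimately show "2 * v $ 1 * v $ 2 = (v $ 3)^2 \<or> v $ 3 = 0"
    by (auto simp: Delta_def)
next
  assume "2 * v $ 1 * v $ 2 = (v $ 3)^2 \<or> v $ 3 = 0"
  then show "row_line v \<subseteq> Delta"
    by (auto simp: row_line_def Delta_def power_mult_distrib) (simp_all add: power2_eq_square mult.assoc)
qed

lemma g_loop_row_line: "g_loop \<alpha> (row_line (vector [a, b, 1])) = extend_to_sphere (g_formula \<alpha> a b)"
  by (simp add: g_loop_def)

text \<open>Avoiding \<open>Delta\<close> allows scaling the third coordinate to 1 and gives
  nondegeneracy. Undoing the inverse in the definition of \<open>line_star\<close> yields hypothesis
  \<open>R2\<close> of \<open>g_permutability\<close> for
  \<open>\<beta> = cnj \<alpha>\<close>.\<close>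

lemma line_star_coords:
  fixes \<alpha> a b
  defines "l \<equiv> row_line (vector [a, b, 1])"
  assumes nd: "2 * a * b \<noteq> 1" and ne: "\<alpha>^6 \<noteq> cnj \<alpha>^6"
    and star: "\<not> line_star \<alpha> l \<subseteq> Delta"
  obtains a' b' k where "line_star \<alpha> l = row_line (vector [a', b', 1])" "2 * a' * b' \<noteq> 1"
    "vector [a', b', 1] v* g_formula \<alpha> a b (cnj \<alpha>) = k *s vector [cnj a, cnj b, 1]"
proof -
  let ?A = "g_formula \<alpha> a b (cnj \<alpha>)"
  define v where "v = vector [cnj a, cnj b, 1] v* matrix_inv ?A"
  have "(\<chi> i. cnj (vector [a, b, 1] $ i)) = (vector [cnj a, cnj b, 1] :: complex^3)"
    by (simp add: vec_eq_iff forall_3)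
  then have l: "line_star \<alpha> l = row_line v"
    by (simp add: line_star_def l_def cnj_line_row_line line_times_row_line g_loop_row_line v_def)
  with star have v3: "v $ 3 \<noteq> 0" and v12: "2 * v $ 1 * v $ 2 \<noteq> (v $ 3)^2"
    by (simp_all add: row_line_subset_Delta_iff)
  define u :: "complex^3" where "u = vector [v $ 1 / v $ 3, v $ 2 / v $ 3, 1]"
  have vu: "v = v $ 3 *s u" using v3 by (simp add: u_def vec_eq_iff forall_3)
  have g: "?A ** flip (g_formula \<alpha> a b (- cnj \<alpha>)) = mat 1" "flip (g_formula \<alpha> a b (- cnj \<alpha>)) ** ?A = mat 1"
    using g_flip[OF nd ne[symmetric]] by simp_all
  have "vector [cnj a, cnj b, 1] = v v* ?A"
    by (simp add: v_def vector_matrix_mul_assoc matrix_inv_eqI[OF g(1)] g(2))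
  also have "\<dots> = v $ 3 *s (u v* ?A)"
    using arg_cong[OF vu, of "\<lambda>x. x v* ?A"] by (simp only: scalar_vector_matrix_assoc)
  finally have "u v* ?A = (1 / v $ 3) *s vector [cnj a, cnj b, 1]"
    using v3 by (simp add: vector_smult_assoc)
  moreover have "line_star \<alpha> l = row_line u"
    unfolding l by (subst vu) (rule row_line_smult[OF v3])
  moreover have "2 * (v $ 1 / v $ 3) * (v $ 2 / v $ 3) \<noteq> 1"
    using v12 v3 by (simp add: field_simps power2_eq_square)
  ultimately show thesis using that unfolding u_def by blast
qed

section \<open>Verification of the loop conditions\<close>

theorem proposition5p4:
  fixes \<alpha> a b :: complex and l :: "(complex^3) set"
  assumes "\<alpha> \<noteq> 0"
    and "Arg \<alpha> \<in> {0<..<pi/6} \<union> {pi/6<..<pi/3}"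
    and "l = row_line (vector [a, b, 1])"
    and "\<not> l \<subseteq> Delta"
    and "\<not> line_star \<alpha> l \<subseteq> Delta"
  shows "f_loop \<alpha> l \<in> twisted_loops_minus GL3"
proof -
  have ne: "\<alpha>^6 \<noteq> cnj \<alpha>^6" using assms by (intro sixth_power_cnj)
  have nd: "2 * a * b \<noteq> 1"
    using assms(3,4) by (simp add: row_line_subset_Delta_iff)
  obtain a' b' k where l': "line_star \<alpha> l = row_line (vector [a', b', 1])" and nd': "2 * a' * b' \<noteq> 1"
    and R: "vector [a', b', 1] v* g_formula \<alpha> a b (cnj \<alpha>) = k *s vector [cnj a, cnj b, 1]"
    using line_star_coords[OF nd ne] assms(3,5) by metis
  have cnd: "2 * cnj x * cnj y \<noteq> 1" if "2 * x * y \<noteq> 1" for x y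
    using that complex_cnj_cancel_iff[of "2 * x * y" 1] by simp
  \<comment> \<open>Conjugating \<open>R\<close> entrywise supplies the other line condition of
    \<open>g_permutability\<close>.\<close>
  have R': "vector [cnj a', cnj b', 1] v* g_formula (cnj \<alpha>) (cnj a) (cnj b) \<alpha> = cnj k *s vector [a, b, 1]"
  proof -
    have "cnj k *s vector [a, b, 1] = (\<chi> i. cnj ((k *s vector [cnj a, cnj b, 1] :: complex^3) $ i))"
      by (simp add: vec_eq_iff forall_3)
    also have "\<dots> = (\<chi> i. cnj ((vector [a', b', 1] v* g_formula \<alpha> a b (cnj \<alpha>)) $ i))"
      by (simp only: R)
    also have "\<dots> = vector [cnj a', cnj b', 1] v* map_matrix cnj (g_formula \<alpha> a b (cnj \<alpha>))"
      by (simp add: mat3 map_matrix_def)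
    finally show ?thesis
      by (simp add: cnj_g)
  qed
  have f_Fin: "f_loop \<alpha> l (Fin z) = g_formula (cnj \<alpha>) a' b' z ** g_formula \<alpha> a b z" for z
    unfolding f_loop_def l' by (simp add: assms(3) g_loop_row_line)
  have f_Infty: "f_loop \<alpha> l Infty = mat 1"
    unfolding f_loop_def l' by (simp add: assms(3) g_loop_row_line g_at_Infty del: extend_to_sphere.simps)
  \<comment> \<open>All poles have modulus \<open>norm \<alpha>\<close>: the bound
    \<open>norm \<alpha>\<close> keeps them off the disc around 0, and
    \<open>1 / norm \<alpha>\<close> off the disc around infinity.\<close>
  obtain r where r: "0 < r" "r < 1" "r < norm \<alpha>" "r < 1 / norm \<alpha>"
    using field_lbound_gt_zero[of "min 1 (norm \<alpha>)" "1 / norm \<alpha>"] assms(1) by auto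
  have not_pole: "z^6 \<noteq> \<alpha>^6" "z^6 \<noteq> cnj \<alpha>^6" if "Fin z \<in> disc_zero r \<union> disc_infinity r" for z
  proof -
    have "1 / r > norm \<alpha>" using r assms(1) by (simp add: field_simps)
    with that r have "norm z \<noteq> norm \<alpha>" by (auto simp: disc_zero_def disc_infinity_def)
    then have "norm z ^ 6 \<noteq> norm \<alpha> ^ 6" by (simp add: power_eq_iff_eq_base)
    then show "z^6 \<noteq> \<alpha>^6" "z^6 \<noteq> cnj \<alpha>^6" by (metis norm_power complex_mod_cnj)+
  qed
  have inv: "f_loop \<alpha> l p \<in> GL3" if "p \<in> disc_zero r \<union> disc_infinity r" for p
  proof (cases p)
    case (Fin z)
    with that not_pole show ?thesis
      by (simp add: GL3_def f_Fin invertible_mult g_invertible nd nd')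
  next
    case Infty
    then show ?thesis by (auto simp: GL3_def f_Infty invertible_def intro: exI[of _ "mat 1"])
  qed
  have hol: "(\<lambda>z. f_loop \<alpha> l (Fin z) $ i $ j) holomorphic_on ball 0 r" for i j
  proof -
    have "z^3 \<noteq> \<alpha>^3 \<and> z^3 \<noteq> cnj \<alpha>^3" if "z \<in> ball 0 r" for z
    proof -
      have "norm z ^ 3 \<noteq> norm \<alpha> ^ 3" using that r by (simp add: power_eq_iff_eq_base)
      then show ?thesis by (metis norm_power complex_mod_cnj)
    qed
    then show ?thesis
      by (auto simp: f_Fin matrix_matrix_mult_def intro!: holomorphic_intros g_formula_holomorphic)
  qed
  have hol_inf: "(\<lambda>w. f_loop \<alpha> l (sphere_inverse w) $ i $ j) holomorphic_on ball 0 r" for i j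
  proof -
    have "\<alpha>^3 * w^3 \<noteq> 1 \<and> cnj \<alpha>^3 * w^3 \<noteq> 1" if "w \<in> ball 0 r" for w
    proof -
      have "norm \<alpha> * norm w < 1"
        using that r(4) assms(1) less_trans[of "norm w" r "1 / norm \<alpha>"]
        by (simp add: pos_less_divide_eq mult.commute)
      then have "norm (\<alpha>^3 * w^3) < 1" "norm (cnj \<alpha>^3 * w^3) < 1"
        by (simp_all add: norm_mult norm_power power_less_one_iff flip: power_mult_distrib)
      then show ?thesis by auto
    qed
    \<comment> \<open>The product of the charts is holomorphic also at \<open>w = 0\<close>, where
      it takes the value \<open>mat 1\<close> of the loop at infinity.\<close>
    then have "(\<lambda>w. (g_chart (cnj \<alpha>) a' b' w ** g_chart \<alpha> a b w) $ i $ j) holomorphic_on ball 0 r"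
      by (auto simp: matrix_matrix_mult_def intro!: holomorphic_intros g_chart_holomorphic)
    moreover have "g_chart (cnj \<alpha>) a' b' w ** g_chart \<alpha> a b w = f_loop \<alpha> l (sphere_inverse w)" for w
    proof (cases "w = 0")
      case True
      moreover have "g_chart \<gamma> p q 0 = mat 1" for \<gamma> p q
        by (simp add: g_chart_def map_matrix_def mat3)
      ultimately show ?thesis by (simp add: sphere_inverse_def f_Infty)
    qed (simp add: sphere_inverse_def f_Fin g_formula_inverse)
    ultimately show ?thesis by simp
  qed
  have real: "map_matrix cnj (f_loop \<alpha> l (sphere_cnj p)) = f_loop \<alpha> l p"
    if "p \<in> disc_zero r \<union> disc_infinity r" for p
  proof (cases p)
    case (Fin z)
    with that not_pole have z: "z^6 \<noteq> \<alpha>^6" "z^6 \<noteq> cnj \<alpha>^6" by auto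
    \<comment> \<open>Conjugation swaps the poles of the two factors, so reality is permutability
      with \<open>\<beta> = cnj \<alpha>\<close>.\<close>
    have "g_formula \<alpha> (cnj a') (cnj b') z ** g_formula (cnj \<alpha>) (cnj a) (cnj b) z
        = g_formula (cnj \<alpha>) a' b' z ** g_formula \<alpha> a b z"
      using assms(1) by (intro g_permutability[OF nd cnd[OF nd] cnd[OF nd'] nd' _ _ ne R' R z]) auto
    then show ?thesis
      by (simp add: Fin f_Fin cnj_matrix_mult cnj_g)
  next
    case Infty
    then show ?thesis by (simp add: f_Infty map_matrix_def mat_def vec_eq_iff)
  qed
  have twist: "sigma (f_loop \<alpha> l p) = f_loop \<alpha> l (sphere_scale eps p)"
    if "p \<in> disc_zero r \<union> disc_infinity r" for p
  proof (cases p)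
    case (Fin z)
    with that not_pole have z: "z^6 \<noteq> \<alpha>^6" "z^6 \<noteq> cnj \<alpha>^6" by auto
    then show ?thesis
      by (simp add: Fin f_Fin sigma_mult g_invertible sigma_g nd nd')
  next
    case Infty
    then show ?thesis by (simp add: f_Infty sigma_mat_1)
  qed
  have "f_loop \<alpha> l \<in> loops_minus_on r GL3"
    using inv hol hol_inf f_Infty by (simp add: loops_minus_on_def)
  then show ?thesis
    using r real twist unfolding twisted_loops_minus_def loops_minus_def by fastforce
qed

end
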